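(* Let $G$ be an $r$-regular graph of order $n$. If $r$ is even, then $$\frac{n}{r+1}\le \gamma^{NN}_{s}(G)\le\frac{r+1}{r+3}\,n,$$ and if $r$ is odd, then $$0\le \gamma^{NN}_{s}(G)\le\frac{r-1}{r+1}\,n.$$ Furthermore, these bounds are sharp (each of them is attained with equality by some regular graph of the corresponding degree parity).
   Context: All graphs are finite and simple. For a vertex $v$, $N[v]=N(v)\cup\{v\}$; for $f:V(G)\to\mathbb{R}$ and $S\subseteq V(G)$, $f(S)=\sum_{v\in S}f(v)$. A nonnegative signed dominating function (NNSDF) of $G$ is a function $f:V(G)\to\{-1,1\}$ with $f(N[v])\ge 0$ for every $v\in V(G)$; $\gamma^{NN}_s(G)$ is the minimum of $f(V(G))$ over all NNSDFs $f$ of $G$.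
   Formalization: The upper bound for even r is stated only for r > 0: for r = 0 and n ≥ 1 isolated vertices the only NNSDF is the constant 1, so the parameter equals n, which exceeds n/3. *)

theory Defs
  imports Complex_Main "HOL-Library.FuncSet" "Graph_Theory.Pair_Digraph"
begin

text \<open>
  A finite simple graph is a \<open>pair_graph\<close> of \<open>Graph_Theory\<close>: a finite vertex set with a
  symmetric loop-free set of arcs, the edge between \<open>u\<close> and \<open>v\<close> being the pair of arcs
  \<open>(u, v)\<close>, \<open>(v, u)\<close>. The vertex set may be empty.
\<close>

definition open_nbhd :: "'a pair_pre_digraph \<Rightarrow> 'a \<Rightarrow> 'a set" where
  "open_nbhd G v = {w. (v, w) \<in> parcs G}"

definition closed_nbhd :: "'a pair_pre_digraph \<Rightarrow> 'a \<Rightarrow> 'a set" where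
  "closed_nbhd G v = open_nbhd G v \<union> {v}"

definition regular_graph :: "nat \<Rightarrow> 'a pair_pre_digraph \<Rightarrow> bool" where
  "regular_graph r G \<longleftrightarrow> pair_graph G \<and> (\<forall>v \<in> pverts G. card (open_nbhd G v) = r)"

text \<open>Values of \<open>f\<close> outside the vertex set are unconstrained and never used.\<close>

definition nnsdf :: "'a pair_pre_digraph \<Rightarrow> ('a \<Rightarrow> real) \<Rightarrow> bool" where
  "nnsdf G f \<longleftrightarrow> f \<in> pverts G \<rightarrow> {-1, 1} \<and> (\<forall>v \<in> pverts G. sum f (closed_nbhd G v) \<ge> 0)"

definition nn_signed_domination_number :: "'a pair_pre_digraph \<Rightarrow> real" where
  "nn_signed_domination_number G = Min {sum f (pverts G) | f. nnsdf G f}"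

text \<open>The minimum is over a finite nonempty set, so \<open>Min\<close> is the actual minimum.\<close>

lemma nnsdf_weights_finite:
  assumes "pair_graph G"
  shows "finite {sum f (pverts G) | f. nnsdf G f}"
proof -
  have fin: "finite (pverts G)"
    using assms by (simp add: pair_graph_def pair_digraph_def pair_fin_digraph_def pair_fin_digraph_axioms_def)
  have "{sum f (pverts G) | f. nnsdf G f}
      \<subseteq> (\<lambda>g. sum g (pverts G)) ` (pverts G \<rightarrow>\<^sub>E {-1, 1 :: real})"
  proof clarify
    fix f assume "nnsdf G f"
    then have "restrict f (pverts G) \<in> pverts G \<rightarrow>\<^sub>E {-1, 1 :: real}"
      by (auto simp: nnsdf_def)
    moreover have "sum f (pverts G) = sum (restrict f (pverts G)) (pverts G)"
      by simp
    ultimately show "sum f (pverts G) \<in> (\<lambda>g. sum g (pverts G)) ` (pverts G \<rightarrow>\<^sub>E {-1, 1})"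
      by blast
  qed
  then show ?thesis
    using fin by (meson finite_PiE finite_imageI finite_insert finite.emptyI finite_subset)
qed

lemma nnsdf_weights_nonempty: "{sum f (pverts G) | f. nnsdf G f} \<noteq> {}"
proof -
  have "nnsdf G (\<lambda>_. 1)" by (simp add: nnsdf_def)
  then show ?thesis by blast
qed

end

theory Submission
  imports Defs
begin

text \<open>
  Put \<open>M = {v. f v = -1}\<close>, so that \<open>f(V) = n - 2|M|\<close>. The lower bounds come from
  \<open>\<Sum>v. f(N[v]) = (r + 1) f(V)\<close>, where \<open>f(N[v])\<close> is odd for even \<open>r\<close>. An upper bound asks for a
  large \<open>M\<close> with \<open>|N[v] \<inter> M| \<le> k = \<lfloor>(r + 1) / 2\<rfloor>\<close> for all \<open>v\<close>, and every inclusion-maximal such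
  \<open>M\<close> is large enough: each vertex outside \<open>M\<close> then has in its closed neighbourhood a vertex of
  the set \<open>S\<close> of those \<open>u\<close> with \<open>|N[u] \<inter> M| = k\<close>. Counting pairs between \<open>S\<close> and \<open>V - M\<close> and
  between \<open>V\<close> and \<open>M\<close> gives \<open>k n \<le> (k + (r + 1 - k) r) |M|\<close>, provided the two naive estimates
  are sharpened by the pairs between \<open>M \<inter> S\<close> and \<open>V - M\<close>.

  Since the weight of an NNSDF is \<open>n\<close> minus an even number, the bounds already determine the
  parameter for \<open>K\<^sub>2\<close>, \<open>K\<^sub>3\<close> and \<open>C\<^sub>5\<close>, which witness sharpness.
\<close>

section \<open>Double counting and maximal capped sets\<close>

lemma sum_card_Int_swap:
  assumes "finite A" "finite B" "\<And>u v. u \<in> A \<Longrightarrow> v \<in> B \<Longrightarrow> v \<in> N u \<longleftrightarrow> u \<in> N v"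
  shows "(\<Sum>u\<in>A. card (N u \<inter> B)) = (\<Sum>v\<in>B. card (N v \<inter> A))"
proof -
  have card_Int: "card (N u \<inter> C) = (\<Sum>v\<in>C. if v \<in> N u then 1 else 0)" if "finite C" for u C
    using that by (simp add: sum.If_cases Int_commute Collect_conj_eq flip: card_eq_sum)
  have "(\<Sum>u\<in>A. card (N u \<inter> B)) = (\<Sum>u\<in>A. \<Sum>v\<in>B. if v \<in> N u then 1 else 0)"
    using assms by (simp add: card_Int)
  also have "\<dots> = (\<Sum>v\<in>B. \<Sum>u\<in>A. if v \<in> N u then 1 else 0)"
    by (rule sum.swap)
  also have "\<dots> = (\<Sum>v\<in>B. card (N v \<inter> A))"
    unfolding card_Int[OF assms(1)] by (intro sum.cong refl if_cong) (metis assms(3))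
  finally show ?thesis .
qed

text \<open>\<open>N\<close> stands for the closed neighbourhoods of an \<open>r\<close>-regular
  graph and \<open>M\<close> for the vertices that will receive the value -1. The factor on the
  right becomes \<open>k * (r + 3)\<close> for \<open>r = 2 * k\<close> and
  \<open>k * (r + 1)\<close> for \<open>r + 1 = 2 * k\<close>.\<close>

lemma large_capped_set:
  fixes N :: "'a \<Rightarrow> 'a set"
  assumes fin: "finite V"
    and sub: "\<And>v. v \<in> V \<Longrightarrow> N v \<subseteq> V"
    and self: "\<And>v. v \<in> V \<Longrightarrow> v \<in> N v"
    and N_sym: "\<And>u v. u \<in> V \<Longrightarrow> v \<in> V \<Longrightarrow> v \<in> N u \<longleftrightarrow> u \<in> N v"
    and card_N: "\<And>v. v \<in> V \<Longrightarrow> card (N v) = r + 1"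
    and k: "1 \<le> k" "k \<le> r"
  obtains M where "M \<subseteq> V" "\<forall>v\<in>V. card (N v \<inter> M) \<le> k"
    "k * card V \<le> card M * (k + (r + 1 - k) * r)"
proof -
  define F where "F = {M. M \<subseteq> V \<and> (\<forall>v\<in>V. card (N v \<inter> M) \<le> k)}"
  have "finite F" "F \<noteq> {}"
    using fin by (auto simp: F_def intro: exI[of _ "{}"])
  from finite_has_maximal[OF this] obtain M where M: "M \<in> F"
    and maximal: "\<And>M'. M' \<in> F \<Longrightarrow> M \<subseteq> M' \<Longrightarrow> M = M'"
    by metis
  have MV: "M \<subseteq> V" and cap: "\<And>v. v \<in> V \<Longrightarrow> card (N v \<inter> M) \<le> k"
    using M by (auto simp: F_def)
  \<comment> \<open>The cap is tight exactly on \<open>S\<close>, and \<open>c\<close> is what a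
    tight closed neighbourhood has left outside \<open>M\<close>. The pairs counted by
    \<open>g\<close> provide the sharpening of the naive estimates.\<close>
  define S where "S = {u\<in>V. card (N u \<inter> M) = k}"
  define m where "m = (\<lambda>u. card (N u \<inter> M))"
  define s where "s = (\<lambda>w. card (N w \<inter> S))"
  define g where "g = (\<lambda>w. card (N w \<inter> (M \<inter> S)))"
  define c where "c = r + 1 - k"
  have SV: "S \<subseteq> V" by (auto simp: S_def)
  have finM: "finite M" and finS: "finite S" using fin MV SV by (auto intro: finite_subset)
  have finN: "finite (N v)" if "v \<in> V" for v using sub[OF that] fin by (rule finite_subset)
  have swap: "(\<Sum>u\<in>A. card (N u \<inter> B)) = (\<Sum>v\<in>B. card (N v \<inter> A))" if "A \<subseteq> V" "B \<subseteq> V" for A B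
    using that fin by (intro sum_card_Int_swap) (auto intro: finite_subset simp: N_sym subset_iff)

  have s_pos: "1 \<le> s w" if w: "w \<in> V - M" for w
  proof -
    \<comment> \<open>By maximality, adding \<open>w\<close> breaks the cap at some
      \<open>u\<close>. One new element adds at most one to the count, so \<open>u\<close> was
      already tight and \<open>w\<close> lies in \<open>N u\<close>.\<close>
    have "insert w M \<notin> F" using maximal[of "insert w M"] w by blast
    then obtain u where u: "u \<in> V" "k < card (N u \<inter> insert w M)"
      using w MV by (auto simp: F_def not_le)
    have "w \<in> N u"
      using u cap[OF u(1)] by (cases "w \<in> N u") auto
    then have "card (N u \<inter> insert w M) = Suc (card (N u \<inter> M))"
      using w finN[OF u(1)] by simp
    then have "u \<in> S" using u cap[OF u(1)] by (simp add: S_def)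
    moreover have "u \<in> N w" using \<open>w \<in> N u\<close> u w N_sym by auto
    ultimately have "N w \<inter> S \<noteq> {}" by auto
    then show ?thesis
      unfolding s_def using finS by (simp add: Suc_le_eq card_gt_0_iff)
  qed

  have card_out: "card (N u \<inter> (V - M)) = c" if "u \<in> S" for u
  proof -
    have "u \<in> V" using that SV by auto
    have "N u \<inter> (V - M) = N u - (N u \<inter> M)" using sub[OF \<open>u \<in> V\<close>] by auto
    then show ?thesis
      using that card_N[OF \<open>u \<in> V\<close>] finN[OF \<open>u \<in> V\<close>]
      by (simp add: card_Diff_subset S_def c_def)
  qed
  have sum_s: "(\<Sum>w\<in>V - M. s w) = c * card S"
    unfolding s_def using swap[of "V - M" S] SV card_out by simp
  have sum_g: "(\<Sum>w\<in>V - M. g w) = c * card (M \<inter> S)"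
    unfolding g_def using swap[of "V - M" "M \<inter> S"] MV card_out by (simp add: le_infI1)
  have sum_m: "(\<Sum>u\<in>V. m u) = (r + 1) * card M"
  proof -
    have "(\<Sum>u\<in>V. m u) = (\<Sum>v\<in>M. card (N v \<inter> V))"
      unfolding m_def using swap[of V M] MV by simp
    also have "\<dots> = (\<Sum>v\<in>M. r + 1)"
    proof (rule sum.cong[OF refl])
      fix v assume "v \<in> M"
      then have "v \<in> V" using MV by auto
      then show "card (N v \<inter> V) = r + 1" by (simp add: card_N sub Int_absorb2)
    qed
    finally show ?thesis by simp
  qed
  have sum_m_split: "(\<Sum>u\<in>V. m u) = k * card S + (\<Sum>u\<in>V - S. m u)"
    using sum.subset_diff[OF SV fin, of m] by (simp add: m_def S_def mult.commute)

  text \<open>A vertex of \<open>M \<inter> S\<close> next to \<open>w \<notin> M\<close> is either a superfluous element of \<open>N[w] \<inter> S\<close>, if \<open>w\<close> is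
    in \<open>S\<close> itself, or an element of \<open>N[w] \<inter> M\<close> with \<open>w\<close> outside \<open>S\<close>.\<close>
  have outside: "g w + k \<le> k * s w + (if w \<in> S then 0 else c * m w)" if w: "w \<in> V - M" for w
  proof (cases "w \<in> S")
    case True
    have "insert w (N w \<inter> (M \<inter> S)) \<subseteq> N w \<inter> S" using True self w by auto
    then have "card (insert w (N w \<inter> (M \<inter> S))) \<le> s w"
      unfolding s_def using finS by (intro card_mono) auto
    then have "g w + 1 \<le> s w" using w finM by (simp add: g_def)
    then have "k * (g w + 1) \<le> k * s w" by (rule mult_le_mono2)
    moreover have "g w \<le> k * g w" using k by simp
    ultimately have "g w + k \<le> k * s w" unfolding distrib_left mult_1_right by linarith
    then show ?thesis using True by simp
  next
    case False
    have "g w \<le> m w" unfolding g_def m_def using finM by (intro card_mono) auto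
    moreover have "1 \<le> c" using k by (simp add: c_def)
    then have "m w \<le> c * m w" by simp
    ultimately have "g w \<le> c * m w" by linarith
    moreover have "k * 1 \<le> k * s w" using s_pos[OF w] by (rule mult_le_mono2)
    ultimately have "g w + k \<le> k * s w + c * m w" by linarith
    then show ?thesis using False by simp
  qed
  have inside: "1 \<le> m w" if "w \<in> M" for w
  proof -
    have "N w \<inter> M \<noteq> {}" using that self MV by auto
    then show ?thesis
      unfolding m_def using finM by (simp add: Suc_le_eq card_gt_0_iff)
  qed
  \<comment> \<open>Sum of \<open>outside\<close> over \<open>V - M\<close>: the double counts
    \<open>sum_g\<close> and \<open>sum_s\<close> evaluate the terms in \<open>g\<close> and
    \<open>s\<close>.\<close>
  have A: "c * card (M \<inter> S) + k * card (V - M) \<le> k * (c * card S) + c * (\<Sum>w\<in>V - M - S. m w)"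
  proof -
    have "c * card (M \<inter> S) + k * card (V - M) = (\<Sum>w\<in>V - M. g w + k)"
      by (simp add: sum.distrib sum_g)
    also have "\<dots> \<le> (\<Sum>w\<in>V - M. k * s w + (if w \<in> S then 0 else c * m w))"
      by (intro sum_mono outside)
    also have "\<dots> = k * (c * card S) + (\<Sum>w\<in>V - M. if w \<in> S then 0 else c * m w)"
      by (simp add: sum.distrib sum_s flip: sum_distrib_left)
    also have "(\<Sum>w\<in>V - M. if w \<in> S then 0 else c * m w) = (\<Sum>w\<in>V - M - S. c * m w)"
      using fin by (intro sum.mono_neutral_cong_right) auto
    finally show ?thesis by (simp add: sum_distrib_left)
  qed
  have B: "card (M - S) \<le> (\<Sum>w\<in>M - S. m w)"
    using sum_mono[of "M - S" "\<lambda>_. 1" m] inside by simp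
  have split: "(\<Sum>w\<in>V - S. m w) = (\<Sum>w\<in>V - M - S. m w) + (\<Sum>w\<in>M - S. m w)"
  proof -
    have "V - S = (V - M - S) \<union> (M - S)" using MV by auto
    then show ?thesis
      using fin finM by (metis (no_types, lifting) Diff_disjoint Diff_Int_distrib2 Int_commute
          empty_Diff finite_Diff sum.union_disjoint)
  qed
  have card_M: "card M = card (M \<inter> S) + card (M - S)"
    using finM by (metis card_Int_Diff)
  \<comment> \<open>\<open>A\<close> accounts for \<open>M \<inter> S\<close> and \<open>c\<close>
    times \<open>B\<close> for \<open>M - S\<close>. The right side is \<open>c\<close> times the
    split sum of \<open>m\<close>, so \<open>sum_m\<close> eliminates \<open>S\<close>; afterwards
    one of the \<open>r + 1\<close> copies of \<open>c * card M\<close> cancels.\<close>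
  have "c * card M + k * card (V - M) \<le> k * (c * card S) + c * (\<Sum>w\<in>V - S. m w)"
    unfolding card_M split distrib_left using A mult_le_mono2[OF B, of c] by linarith
  also have "\<dots> = c * ((r + 1) * card M)"
    using sum_m sum_m_split by (metis distrib_left mult.left_commute)
  finally have "k * card (V - M) \<le> c * r * card M"
    by (simp add: algebra_simps)
  moreover have "card V = card (V - M) + card M"
    using card_Diff_subset[OF finM MV] card_mono[OF fin MV] by simp
  ultimately have "k * card V \<le> card M * (k + c * r)"
    by (simp add: algebra_simps)
  with that[OF MV] cap show ?thesis by (simp add: c_def)
qed

section \<open>Sign functions on regular graphs and the four bounds\<close>

lemma sum_sign:
  fixes f :: "'a \<Rightarrow> real"
  assumes "finite A" "f \<in> A \<rightarrow> {-1, 1}"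
  shows "sum f A = real (card A) - 2 * real (card {v\<in>A. f v = -1})"
proof -
  have "sum f A = (\<Sum>v\<in>A. 1 - (if f v = -1 then 2 else 0))"
    using assms(2) by (intro sum.cong) auto
  also have "\<dots> = real (card A) - 2 * real (card {v\<in>A. f v = -1})"
    using assms(1) by (simp add: sum_subtractf sum.If_cases Collect_conj_eq)
  finally show ?thesis .
qed

locale regular =
  fixes r :: nat and G :: "'a pair_pre_digraph"
  assumes regular: "regular_graph r G"
begin

sublocale pair_graph G
  using regular by (simp add: regular_graph_def)

lemma closed_nbhd_subset: "v \<in> pverts G \<Longrightarrow> closed_nbhd G v \<subseteq> pverts G"
  by (auto simp: closed_nbhd_def open_nbhd_def dest: in_arcsD2)

lemma closed_nbhd_sym: "u \<in> closed_nbhd G v \<longleftrightarrow> v \<in> closed_nbhd G u"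
  by (auto simp: closed_nbhd_def open_nbhd_def dest: arcs_symmetric)

lemma card_closed_nbhd: "v \<in> pverts G \<Longrightarrow> card (closed_nbhd G v) = r + 1"
proof -
  assume v: "v \<in> pverts G"
  have "v \<notin> open_nbhd G v"
    by (auto simp: open_nbhd_def dest: no_loops')
  moreover have "finite (open_nbhd G v)"
    using finite_subset[OF closed_nbhd_subset[OF v] finite_verts] by (simp add: closed_nbhd_def)
  ultimately show ?thesis
    using regular v by (simp add: closed_nbhd_def regular_graph_def)
qed

lemma finite_closed_nbhd: "v \<in> pverts G \<Longrightarrow> finite (closed_nbhd G v)"
  by (rule finite_subset[OF closed_nbhd_subset finite_verts])

text \<open>By symmetry each value \<open>f u\<close> is counted once for every \<open>v\<close> in
  the closed neighbourhood of \<open>u\<close>, that is \<open>r + 1\<close> times.\<close>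

lemma sum_closed_nbhd:
  fixes f :: "'a \<Rightarrow> real"
  shows "(\<Sum>v\<in>pverts G. sum f (closed_nbhd G v)) = (real r + 1) * sum f (pverts G)"
proof -
  let ?V = "pverts G"
  have "(\<Sum>v\<in>?V. sum f (closed_nbhd G v)) = (\<Sum>v\<in>?V. \<Sum>u\<in>?V. if u \<in> closed_nbhd G v then f u else 0)"
    using closed_nbhd_subset
    by (intro sum.cong refl sum.mono_neutral_cong_left) (auto simp: subset_iff)
  also have "\<dots> = (\<Sum>u\<in>?V. \<Sum>v\<in>?V. if v \<in> closed_nbhd G u then f u else 0)"
    by (subst sum.swap) (simp add: closed_nbhd_sym)
  also have "\<dots> = (\<Sum>u\<in>?V. \<Sum>v\<in>closed_nbhd G u. f u)"
    using closed_nbhd_subset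
    by (intro sum.cong refl sum.mono_neutral_cong_right) (auto simp: subset_iff)
  also have "\<dots> = (real r + 1) * sum f ?V"
    by (simp add: card_closed_nbhd sum_distrib_left add.commute)
  finally show ?thesis .
qed

lemma nn_signed_domination_number_attained:
  obtains f where "nnsdf G f" "nn_signed_domination_number G = sum f (pverts G)"
  using Min_in[OF nnsdf_weights_finite[OF pair_graph_axioms] nnsdf_weights_nonempty]
  unfolding nn_signed_domination_number_def by blast

lemma nn_signed_domination_number_le:
  "nnsdf G f \<Longrightarrow> nn_signed_domination_number G \<le> sum f (pverts G)"
  unfolding nn_signed_domination_number_def
  by (intro Min_le nnsdf_weights_finite pair_graph_axioms) auto

lemma nn_signed_domination_number_parity:
  "\<exists>m::nat. nn_signed_domination_number G = real (card (pverts G)) - 2 * real m"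
proof -
  obtain f where f: "nnsdf G f" "nn_signed_domination_number G = sum f (pverts G)"
    by (rule nn_signed_domination_number_attained)
  then show ?thesis
    using sum_sign[OF finite_verts, of f] by (auto simp: nnsdf_def)
qed

lemma nn_signed_domination_number_ge_0: "0 \<le> nn_signed_domination_number G"
proof -
  obtain f where f: "nnsdf G f" "nn_signed_domination_number G = sum f (pverts G)"
    by (rule nn_signed_domination_number_attained)
  have "0 \<le> (\<Sum>v\<in>pverts G. sum f (closed_nbhd G v))"
    using f(1) by (intro sum_nonneg[of "pverts G"]) (simp add: nnsdf_def)
  then have "0 \<le> (real r + 1) * sum f (pverts G)"
    by (simp add: sum_closed_nbhd)
  then show ?thesis
    using f(2) by (simp add: zero_le_mult_iff)
qed

lemma even_lower_bound:
  assumes "even r"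
  shows "real (card (pverts G)) / (real r + 1) \<le> nn_signed_domination_number G"
proof -
  obtain f where f: "nnsdf G f" "nn_signed_domination_number G = sum f (pverts G)"
    by (rule nn_signed_domination_number_attained)
  \<comment> \<open>A sum of \<open>r + 1\<close> signs is odd for even \<open>r\<close>, so being
    nonnegative it is at least 1.\<close>
  have "1 \<le> sum f (closed_nbhd G v)" if v: "v \<in> pverts G" for v
  proof -
    have "f \<in> closed_nbhd G v \<rightarrow> {-1, 1}"
      using f(1) closed_nbhd_subset[OF v] by (auto simp: nnsdf_def)
    from sum_sign[OF finite_closed_nbhd[OF v] this]
    obtain j :: nat where j: "sum f (closed_nbhd G v) = real (r + 1) - 2 * real j"
      unfolding card_closed_nbhd[OF v] by blast
    moreover have "0 \<le> sum f (closed_nbhd G v)"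
      using f(1) v by (simp add: nnsdf_def)
    ultimately have "2 * j \<le> r + 1" by linarith
    with \<open>even r\<close> have "2 * j \<le> r" by presburger
    with j show ?thesis by simp
  qed
  then have "(\<Sum>v\<in>pverts G. 1) \<le> (\<Sum>v\<in>pverts G. sum f (closed_nbhd G v))"
    by (intro sum_mono)
  then show ?thesis
    by (simp add: sum_closed_nbhd f(2) divide_simps mult.commute)
qed

text \<open>With at most \<open>k\<close> values -1 among \<open>r + 1\<close>, a closed
  neighbourhood has sum at least \<open>r + 1 - 2 * k\<close>, which is nonnegative by the third
  assumption. The number \<open>a\<close> is the size of the set from
  \<open>large_capped_set\<close>.\<close>

lemma upper_bound:
  assumes "1 \<le> k" "k \<le> r" "2 * k \<le> r + 1"
  obtains a :: nat where
    "nn_signed_domination_number G \<le> real (card (pverts G)) - 2 * real a"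
    "k * card (pverts G) \<le> a * (k + (r + 1 - k) * r)"
proof -
  have self: "v \<in> closed_nbhd G v" for v
    by (simp add: closed_nbhd_def)
  obtain M where M: "M \<subseteq> pverts G" "\<forall>v\<in>pverts G. card (closed_nbhd G v \<inter> M) \<le> k"
    "k * card (pverts G) \<le> card M * (k + (r + 1 - k) * r)"
    by (rule large_capped_set[OF finite_verts closed_nbhd_subset self closed_nbhd_sym
          card_closed_nbhd assms(1,2)])
  define f where "f = (\<lambda>v. if v \<in> M then -1 else 1 :: real)"
  have f: "f \<in> A \<rightarrow> {-1, 1}" and neg: "{v\<in>A. f v = -1} = A \<inter> M" for A
    by (auto simp: f_def)
  have "nnsdf G f"
    unfolding nnsdf_def
  proof (intro conjI ballI f)
    fix v assume v: "v \<in> pverts G"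
    have "2 * card (closed_nbhd G v \<inter> M) \<le> r + 1"
      using bspec[OF M(2) v] assms(3) by linarith
    then show "0 \<le> sum f (closed_nbhd G v)"
      using sum_sign[OF finite_closed_nbhd[OF v] f] card_closed_nbhd[OF v] by (simp add: neg)
  qed
  moreover have "sum f (pverts G) = real (card (pverts G)) - 2 * real (card M)"
    using sum_sign[OF finite_verts f] M(1) by (simp add: neg Int_absorb1)
  ultimately show ?thesis
    using that[OF _ M(3)] nn_signed_domination_number_le[of f] by simp
qed

text \<open>The case \<open>r = 0\<close> is a genuine exception: without edges every vertex must
  have value 1, so the parameter is the order of the graph and not at most a third of it, unless the
  graph is empty.\<close>

lemma even_upper_bound:
  assumes "even r" "r > 0"
  shows "nn_signed_domination_number G \<le> (real r + 1) / (real r + 3) * real (card (pverts G))"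
proof -
  obtain k where k: "r = 2 * k" using \<open>even r\<close> by blast
  with \<open>r > 0\<close> have "1 \<le> k" by simp
  then obtain a where a: "nn_signed_domination_number G \<le> real (card (pverts G)) - 2 * real a"
    "k * card (pverts G) \<le> a * (k + (r + 1 - k) * r)"
    using upper_bound[of k] k by auto
  have "k + (r + 1 - k) * r = k * (r + 3)"
    using k by (simp add: algebra_simps)
  with a(2) have "k * card (pverts G) \<le> k * (a * (r + 3))"
    by (simp only: mult.left_commute)
  then have "card (pverts G) \<le> a * (r + 3)"
    using \<open>1 \<le> k\<close> by simp
  then have "real (card (pverts G)) \<le> real (a * (r + 3))"
    by (rule of_nat_mono)
  \<comment> \<open>Here \<open>a\<close> is at least the order divided by \<open>r + 3\<close>, and
    \<open>1 - 2 / (r + 3) = (r + 1) / (r + 3)\<close>.\<close>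
  then have "real (card (pverts G)) - 2 * real a \<le> (real r + 1) / (real r + 3) * real (card (pverts G))"
    by (simp add: field_simps)
  with a(1) show ?thesis by linarith
qed

lemma odd_upper_bound:
  assumes "odd r"
  shows "nn_signed_domination_number G \<le> (real r - 1) / (real r + 1) * real (card (pverts G))"
proof -
  obtain j where j: "r = 2 * j + 1" using \<open>odd r\<close> by (rule oddE)
  \<comment> \<open>This is \<open>(r + 1) / 2\<close>, the largest cap allowed by
    \<open>2 * k \<le> r + 1\<close>.\<close>
  define k where "k = j + 1"
  obtain a where a: "nn_signed_domination_number G \<le> real (card (pverts G)) - 2 * real a"
    "k * card (pverts G) \<le> a * (k + (r + 1 - k) * r)"
    using upper_bound[of k] j by (auto simp: k_def)
  have "k + (r + 1 - k) * r = k * (r + 1)"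
    unfolding j k_def by (simp add: algebra_simps)
  with a(2) have "k * card (pverts G) \<le> k * (a * (r + 1))"
    by (simp only: mult.left_commute)
  then have "card (pverts G) \<le> a * (r + 1)"
    by (subst (asm) mult_le_cancel1) (simp add: k_def)
  then have "real (card (pverts G)) \<le> real (a * (r + 1))"
    by (rule of_nat_mono)
  then have "real (card (pverts G)) - 2 * real a \<le> (real r - 1) / (real r + 1) * real (card (pverts G))"
    by (simp add: field_simps)
  with a(1) show ?thesis by linarith
qed

end

section \<open>Cycles and the sharpness examples\<close>

text \<open>For \<open>n = 2\<close> this is \<open>K\<^sub>2\<close>.\<close>
definition cycle_graph :: "nat \<Rightarrow> nat pair_pre_digraph" where
  "cycle_graph n = \<lparr>pverts = {..<n},
     parcs = {(i, j). i < n \<and> j < n \<and> (j = Suc i mod n \<or> i = Suc j mod n)}\<rparr>"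

lemma pair_graph_cycle_graph:
  assumes "2 \<le> n"
  shows "pair_graph (cycle_graph n)"
proof
  have "parcs (cycle_graph n) \<subseteq> {..<n} \<times> {..<n}"
    by (auto simp: cycle_graph_def)
  then show "finite (parcs (cycle_graph n))"
    by (rule finite_subset) simp
  have neq: "Suc i mod n \<noteq> i" if "i < n" for i
    using that assms by (cases "Suc i = n") auto
  show "fst e \<noteq> snd e" if "e \<in> parcs (cycle_graph n)" for e
    using that by (cases e) (clarsimp simp: cycle_graph_def, metis neq)
qed (auto simp: cycle_graph_def symmetric_def intro!: symI)

text \<open>The second element is the predecessor modulo \<open>n\<close>. Truncated subtraction
  would send 0 to 0 instead of \<open>n - 1\<close>, hence the case distinction.\<close>

lemma open_nbhd_cycle_graph:
  assumes "v < n"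
  shows "open_nbhd (cycle_graph n) v = {Suc v mod n, if v = 0 then n - 1 else v - 1}"
proof -
  have "Suc w mod n = (if Suc w = n then 0 else Suc w)" if "w < n" for w
    using that by simp
  then have "w < n \<and> v = Suc w mod n \<longleftrightarrow> w = (if v = 0 then n - 1 else v - 1)" for w
    using assms by (cases "w < n"; simp) arith+
  moreover have "Suc v mod n < n" using assms by simp
  ultimately have "v < n \<and> w < n \<and> (w = Suc v mod n \<or> v = Suc w mod n) \<longleftrightarrow>
      w = Suc v mod n \<or> w = (if v = 0 then n - 1 else v - 1)" for w
    using assms by metis
  then show ?thesis
    unfolding open_nbhd_def cycle_graph_def by (intro equalityI subsetI) simp_all
qed

text \<open>Successor and predecessor modulo \<open>n\<close> coincide for \<open>n = 2\<close> and
  differ for \<open>n \<ge> 3\<close>.\<close>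

lemma regular_cycle_graph:
  "regular_graph 1 (cycle_graph 2)"
  "3 \<le> n \<Longrightarrow> regular_graph 2 (cycle_graph n)"
proof -
  have V: "pverts (cycle_graph n) = {..<n}" for n
    by (simp add: cycle_graph_def)
  have "open_nbhd (cycle_graph 2) v = {1 - v}" if "v < 2" for v
    using that open_nbhd_cycle_graph[OF that] by (cases "v = 0") (simp_all add: less_2_cases_iff)
  then show "regular_graph 1 (cycle_graph 2)"
    by (simp add: regular_graph_def pair_graph_cycle_graph V)
  assume n: "3 \<le> n"
  have "Suc v mod n \<noteq> (if v = 0 then n - 1 else v - 1)" if "v < n" for v
    using that n by (cases "Suc v = n") auto
  then show "regular_graph 2 (cycle_graph n)"
    using n by (simp add: regular_graph_def pair_graph_cycle_graph V open_nbhd_cycle_graph)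
qed

lemma nn_signed_domination_number_cycle_graph:
  "nn_signed_domination_number (cycle_graph 2) = 0"
  "nn_signed_domination_number (cycle_graph 3) = 1"
  "nn_signed_domination_number (cycle_graph 5) = 3"
proof -
  have V: "card (pverts (cycle_graph n)) = n" for n
    by (simp add: cycle_graph_def)
  interpret C2: regular 1 "cycle_graph 2" by standard (rule regular_cycle_graph)
  interpret C3: regular 2 "cycle_graph 3" by standard (simp add: regular_cycle_graph)
  interpret C5: regular 2 "cycle_graph 5" by standard (simp add: regular_cycle_graph)
  \<comment> \<open>For degree 1 both odd bounds are 0.\<close>
  show "nn_signed_domination_number (cycle_graph 2) = 0"
    using C2.nn_signed_domination_number_ge_0 C2.odd_upper_bound by simp
  \<comment> \<open>The bounds are 1 and 9/5, and the value is odd.\<close>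
  show "nn_signed_domination_number (cycle_graph 3) = 1"
    using C3.nn_signed_domination_number_parity C3.even_lower_bound C3.even_upper_bound
    by (auto simp: V)
  \<comment> \<open>The bounds are 5/3 and 3, and the value is odd.\<close>
  show "nn_signed_domination_number (cycle_graph 5) = 3"
    using C5.nn_signed_domination_number_parity C5.even_lower_bound C5.even_upper_bound
    by (auto simp: V)
qed

text \<open>The sharpness claims ask for a nonempty \<open>H\<close>, since all bounds are 0 for the
  empty graph. For even degree they ask for \<open>s > 0\<close>, since edgeless graphs attain the
  lower bound trivially.\<close>

theorem theorem2p2:
  fixes G :: "'a pair_pre_digraph" and r n :: nat
  assumes "regular_graph r G" and "card (pverts G) = n"
  shows
    "(even r \<longrightarrow>
        real n / (real r + 1) \<le> nn_signed_domination_number G \<and>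
        (r > 0 \<longrightarrow> nn_signed_domination_number G \<le> (real r + 1) / (real r + 3) * real n)) \<and>
     (odd r \<longrightarrow>
        0 \<le> nn_signed_domination_number G \<and>
        nn_signed_domination_number G \<le> (real r - 1) / (real r + 1) * real n) \<and>
     (\<exists>(H :: nat pair_pre_digraph) s. regular_graph s H \<and> pverts H \<noteq> {} \<and> even s \<and> s > 0 \<and>
        nn_signed_domination_number H = real (card (pverts H)) / (real s + 1)) \<and>
     (\<exists>(H :: nat pair_pre_digraph) s. regular_graph s H \<and> pverts H \<noteq> {} \<and> even s \<and> s > 0 \<and>
        nn_signed_domination_number H = (real s + 1) / (real s + 3) * real (card (pverts H))) \<and>
     (\<exists>(H :: nat pair_pre_digraph) s. regular_graph s H \<and> pverts H \<noteq> {} \<and> odd s \<and>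
        nn_signed_domination_number H = 0) \<and>
     (\<exists>(H :: nat pair_pre_digraph) s. regular_graph s H \<and> pverts H \<noteq> {} \<and> odd s \<and>
        nn_signed_domination_number H = (real s - 1) / (real s + 1) * real (card (pverts H)))"
proof -
  interpret regular r G by standard (rule assms(1))
  have V: "card (pverts (cycle_graph m)) = m" "pverts (cycle_graph m) \<noteq> {} \<longleftrightarrow> m > 0" for m
    by (auto simp: cycle_graph_def)
  note facts = regular_cycle_graph nn_signed_domination_number_cycle_graph V
  show ?thesis
  proof (intro conjI impI)
    show "\<exists>(H :: nat pair_pre_digraph) s. regular_graph s H \<and> pverts H \<noteq> {} \<and> even s \<and> s > 0 \<and>
        nn_signed_domination_number H = real (card (pverts H)) / (real s + 1)"
      by (rule exI[of _ "cycle_graph 3"], rule exI[of _ 2]) (simp add: facts)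
    show "\<exists>(H :: nat pair_pre_digraph) s. regular_graph s H \<and> pverts H \<noteq> {} \<and> even s \<and> s > 0 \<and>
        nn_signed_domination_number H = (real s + 1) / (real s + 3) * real (card (pverts H))"
      by (rule exI[of _ "cycle_graph 5"], rule exI[of _ 2]) (simp add: facts)
    show "\<exists>(H :: nat pair_pre_digraph) s. regular_graph s H \<and> pverts H \<noteq> {} \<and> odd s \<and>
        nn_signed_domination_number H = 0"
      by (rule exI[of _ "cycle_graph 2"], rule exI[of _ 1]) (use facts in simp)
    show "\<exists>(H :: nat pair_pre_digraph) s. regular_graph s H \<and> pverts H \<noteq> {} \<and> odd s \<and>
        nn_signed_domination_number H = (real s - 1) / (real s + 1) * real (card (pverts H))"
      by (rule exI[of _ "cycle_graph 2"], rule exI[of _ 1]) (use facts in simp)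
  qed (use even_lower_bound even_upper_bound odd_upper_bound
      nn_signed_domination_number_ge_0 in \<open>simp_all add: flip: assms(2)\<close>)
qed

end
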